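(* Let $\rho,\alpha>0$ and, for $a,b\ge 0$, consider the system for real-valued functions $(U,V)$ $$(\mathrm{S}_{a,b})\qquad \begin{cases}U''-U^3-\alpha (V+\rho)U=0\\ (aV^2-bV^3)'=\alpha (U^2)'\end{cases}\qquad\text{in }\mathbb{R}.$$ Then: 1. Assume that $a=0$. Then there exists $b>0$ such that $(\mathrm{S}_{0,b})$ admits a solution $(U,V)$ with $$U\in H_{rd}^1(\mathbb{R})\text{ positive},\qquad V(x)=-\left(\frac{\alpha}{b}\right)^{1/3}U^{2/3}(x).$$ 2. Assume that $b=0$. Then there exists $a>0$ such that $(\mathrm{S}_{a,0})$ admits a solution $(U,V)$ with $$U\in H_{rd}^1(\mathbb{R})\text{ positive},\qquad V(x)=-\left(\frac{\alpha}{a}\right)^{1/2}U(x).$$ 3. There exist $a,b>0$ such that $(\mathrm{S}_{a,b})$ admits a solution $(U,V)$ with $U>0$ and $U\in H^1_{rd}(\mathbb{R})$, and $V<0$ with $aV^2-bV^3=\alpha U^2$ a.e.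
   Context: $H^1_{rd}(\mathbb{R})$ denotes the set of (real-valued) functions in $H^1(\mathbb{R})$ which are even and decreasing in $|x|$. *)

theory Defs
  imports "HOL-Analysis.Analysis"
begin

text \<open>
  Elements of \<open>L\<^sup>2\<close>, \<open>L\<^sup>1\<^sub>l\<^sub>o\<^sub>c\<close> and \<open>H\<^sup>1\<close> are represented by actual functions \<open>real \<Rightarrow> real\<close>
  (representatives of their classes modulo Lebesgue-null sets).
\<close>

definition test_function :: "(real \<Rightarrow> real) \<Rightarrow> bool" where
  "test_function \<phi> \<longleftrightarrow>
     (\<forall>k. (deriv ^^ k) \<phi> differentiable_on UNIV) \<and> compact (closure {x. \<phi> x \<noteq> 0})"

definition locally_integrable :: "(real \<Rightarrow> real) \<Rightarrow> bool" where
  "locally_integrable f \<longleftrightarrow> (\<forall>K. compact K \<longrightarrow> set_integrable lebesgue K f)"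

definition L2 :: "(real \<Rightarrow> real) set" where
  "L2 = {f. f \<in> borel_measurable lebesgue \<and> integrable lebesgue (\<lambda>x. (f x)\<^sup>2)}"

definition has_weak_deriv :: "(real \<Rightarrow> real) \<Rightarrow> (real \<Rightarrow> real) \<Rightarrow> bool" where
  "has_weak_deriv f g \<longleftrightarrow>
     locally_integrable f \<and> locally_integrable g \<and>
     (\<forall>\<phi>. test_function \<phi> \<longrightarrow>
        (LINT x|lebesgue. f x * deriv \<phi> x) = - (LINT x|lebesgue. g x * \<phi> x))"

definition H1 :: "(real \<Rightarrow> real) set" where
  "H1 = {u \<in> L2. \<exists>g \<in> L2. has_weak_deriv u g}"

text \<open>``Decreasing'' is meant in the wide sense (non-increasing), as is usual for symmetrized functions.\<close>

definition H1_rd :: "(real \<Rightarrow> real) set" where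
  "H1_rd = {u \<in> H1. (\<forall>x. u (- x) = u x) \<and> (\<forall>x y. \<bar>x\<bar> \<le> \<bar>y\<bar> \<longrightarrow> u y \<le> u x)}"

text \<open>
  Real-valued solutions of the system
  \<open>U'' - U\<^sup>3 - \<alpha> (V + \<rho>) U = 0\<close>, \<open>(a V\<^sup>2 - b V\<^sup>3)' = \<alpha> (U\<^sup>2)'\<close>
  in the sense of distributions on the real line. Local integrability is required of every term,
  since the Bochner integral of a non-integrable function is \<open>0\<close> by convention.
\<close>

definition solves_system ::
  "real \<Rightarrow> real \<Rightarrow> real \<Rightarrow> real \<Rightarrow> (real \<Rightarrow> real) \<Rightarrow> (real \<Rightarrow> real) \<Rightarrow> bool" where
  "solves_system \<rho> \<alpha> a b U V \<longleftrightarrow>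
     locally_integrable U \<and> locally_integrable V \<and>
     locally_integrable (\<lambda>x. U x ^ 3) \<and>
     locally_integrable (\<lambda>x. (V x + \<rho>) * U x) \<and>
     locally_integrable (\<lambda>x. a * (V x)\<^sup>2 - b * V x ^ 3) \<and>
     locally_integrable (\<lambda>x. (U x)\<^sup>2) \<and>
     (\<forall>\<phi>. test_function \<phi> \<longrightarrow>
        (LINT x|lebesgue. U x * deriv (deriv \<phi>) x
            - U x ^ 3 * \<phi> x - \<alpha> * (V x + \<rho>) * U x * \<phi> x) = 0) \<and>
     (\<forall>\<phi>. test_function \<phi> \<longrightarrow>
        - (LINT x|lebesgue. (a * (V x)\<^sup>2 - b * V x ^ 3) * deriv \<phi> x)
          = - (LINT x|lebesgue. \<alpha> * (U x)\<^sup>2 * deriv \<phi> x))"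

end

theory Submission
  imports Defs "HOL-Probability.Sinc_Integral"
begin

text \<open>
  Write \<open>V = - v\<close> with \<open>\<alpha> U\<^sup>2 = a v\<^sup>2 + b v\<^sup>3\<close>. The equation for \<open>U\<close> then has the first integral
  \<open>U'\<^sup>2 = \<alpha> \<rho> U\<^sup>2 + U\<^sup>4 / 2 - 2 \<alpha> \<integral> v U dU\<close>, which in terms of \<open>v\<close> reads \<open>v'\<^sup>2 = v\<^sup>2 G(v)\<close> with a
  rational function \<open>G\<close>. Since \<open>a\<close> and \<open>b\<close> are ours to choose, we choose them so that the smallest
  positive zero \<open>m\<close> of \<open>G\<close> is explicit and simple, i.e. \<open>G(v) = (m - v) K(v)\<close> with \<open>K > 0\<close> on
  \<open>[0, m]\<close>. The substitution \<open>v = m (1 - tanh\<^sup>2 y)\<close> removes the degeneracies at \<open>v = 0\<close> and \<open>v = m\<close>: it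
  turns the equation into \<open>y' = \<surd>(m K(v)) / 2\<close>, whose right-hand side is bounded between two
  positive constants, so that separation of variables gives a global solution.
\<close>

section \<open>Integrability on the line and integration by parts against test functions\<close>

lemma integrable_lebesgue_continuous:
  fixes f :: "real \<Rightarrow> real"
  assumes "continuous_on UNIV f" and "integrable lborel f"
  shows "integrable lebesgue f"
proof -
  have "f \<in> borel_measurable lborel"
    using assms(1) by (simp add: borel_measurable_continuous_onI)
  with assms(2) show ?thesis
    by (simp add: integrable_completion)
qed

lemma locally_integrable_continuous:
  assumes "continuous_on UNIV f"
  shows "locally_integrable f"
  unfolding locally_integrable_def set_integrable_def
proof (intro allI impI)
  fix K :: "real set"
  assume K: "compact K"
  have "integrable lborel (\<lambda>x. indicator K x *\<^sub>R f x)"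
    using K assms by (intro borel_integrable_compact) (auto intro: continuous_on_subset)
  moreover have "(\<lambda>x. indicator K x *\<^sub>R f x) \<in> borel_measurable lborel"
    using calculation by (rule borel_measurable_integrable)
  ultimately show "integrable lebesgue (\<lambda>x. indicator K x *\<^sub>R f x)"
    by (simp add: integrable_completion)
qed

lemma integrable_compact_support:
  fixes f :: "real \<Rightarrow> real"
  assumes cont: "continuous_on UNIV f" and supp: "\<And>x. x \<notin> {-R..R} \<Longrightarrow> f x = 0"
  shows "integrable lborel f" and "integrable lebesgue f"
proof -
  have "integrable lborel (\<lambda>x. indicator {-R..R} x *\<^sub>R f x)"
    using cont by (intro borel_integrable_compact) (auto intro: continuous_on_subset)
  moreover have "(\<lambda>x. indicator {-R..R} x *\<^sub>R f x) = f"
    using supp by (auto simp: indicator_def fun_eq_iff)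
  ultimately show *: "integrable lborel f"
    by simp
  show "integrable lebesgue f"
    using cont * by (rule integrable_lebesgue_continuous)
qed

lemma integrable_lebesgue_quadratic_decay:
  fixes f :: "real \<Rightarrow> real"
  assumes cont: "continuous_on UNIV f" and "\<And>x. \<bar>f x\<bar> \<le> C * inverse (1 + x\<^sup>2)"
  shows "integrable lebesgue f"
proof (rule integrable_lebesgue_continuous[OF cont])
  have "integrable lborel (\<lambda>x::real. inverse (1 + x\<^sup>2))"
    using integrable_inverse_1_plus_square by (simp add: set_integrable_def einterval_def)
  then have "integrable lborel (\<lambda>x::real. C * inverse (1 + x\<^sup>2))"
    by simp
  then show "integrable lborel f"
    by (rule Bochner_Integration.integrable_bound)
      (use assms in \<open>auto intro!: borel_measurable_continuous_onI intro: order_trans[OF _ abs_ge_self]\<close>)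
qed

lemma test_function_deriv:
  assumes "test_function \<phi>"
  shows "test_function (deriv \<phi>)"
  unfolding test_function_def
proof (intro conjI allI)
  fix k
  have "(deriv ^^ Suc k) \<phi> differentiable_on UNIV"
    using assms unfolding test_function_def by blast
  then show "(deriv ^^ k) (deriv \<phi>) differentiable_on UNIV"
    by (simp add: funpow_swap1)
next
  let ?S = "closure {x. \<phi> x \<noteq> 0}"
  have "deriv \<phi> x = 0" if "x \<notin> ?S" for x
  proof -
    have "eventually (\<lambda>y. y \<in> - ?S) (nhds x)"
      using that by (intro eventually_nhds_in_open) auto
    then have "eventually (\<lambda>y. \<phi> y = 0) (nhds x)"
      using closure_subset[of "{x. \<phi> x \<noteq> 0}"] by (auto elim!: eventually_mono)
    then have "deriv \<phi> x = deriv (\<lambda>_. 0) x"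
      by (rule deriv_cong_ev) simp
    then show ?thesis by simp
  qed
  then have "closure {x. deriv \<phi> x \<noteq> 0} \<subseteq> ?S"
    by (intro closure_minimal) auto
  moreover have "compact ?S"
    using assms by (simp add: test_function_def)
  ultimately show "compact (closure {x. deriv \<phi> x \<noteq> 0})"
    by (metis closed_closure closed_Int_compact inf.absorb1)
qed

lemma test_function_has_deriv:
  assumes "test_function \<phi>"
  shows "(\<phi> has_real_derivative deriv \<phi> x) (at x)"
proof -
  have "(deriv ^^ 0) \<phi> differentiable_on UNIV"
    using assms unfolding test_function_def by blast
  then have "\<phi> differentiable (at x)"
    by (simp add: differentiable_on_def)
  then show ?thesis
    by (simp add: DERIV_deriv_iff_real_differentiable)
qed

lemma test_function_continuous:
  assumes "test_function \<phi>"
  shows "continuous_on A \<phi>"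
  using test_function_has_deriv[OF assms]
  by (meson DERIV_isCont continuous_at_imp_continuous_on)

lemma test_function_support:
  assumes "test_function \<phi>"
  shows "\<exists>R>0. \<forall>x. R \<le> \<bar>x\<bar> \<longrightarrow> \<phi> x = 0 \<and> deriv \<phi> x = 0"
proof -
  have *: "\<exists>R>0. \<forall>x. R \<le> \<bar>x\<bar> \<longrightarrow> \<psi> x = 0" if "test_function \<psi>" for \<psi>
  proof -
    have "bounded (closure {x. \<psi> x \<noteq> 0})"
      using that by (simp add: test_function_def compact_imp_bounded)
    then obtain B where "B > 0" and B: "\<And>x. x \<in> closure {x. \<psi> x \<noteq> 0} \<Longrightarrow> norm x \<le> B"
      by (meson bounded_pos)
    then have "\<psi> x = 0" if "B + 1 \<le> \<bar>x\<bar>" for x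
      using that B[of x] closure_subset[of "{x. \<psi> x \<noteq> 0}"] by fastforce
    with \<open>B > 0\<close> show ?thesis
      by (intro exI[of _ "B + 1"]) auto
  qed
  obtain R1 where "R1 > 0" "\<forall>x. R1 \<le> \<bar>x\<bar> \<longrightarrow> \<phi> x = 0"
    using *[OF assms] by blast
  moreover obtain R2 where "R2 > 0" "\<forall>x. R2 \<le> \<bar>x\<bar> \<longrightarrow> deriv \<phi> x = 0"
    using *[OF test_function_deriv[OF assms]] by blast
  ultimately show ?thesis
    by (intro exI[of _ "max R1 R2"]) auto
qed

lemma integrable_mult_test_function:
  assumes "continuous_on UNIV F" and "test_function \<phi>"
  shows "integrable lborel (\<lambda>x. F x * \<phi> x)" and "integrable lebesgue (\<lambda>x. F x * \<phi> x)"
proof -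
  obtain R where R: "\<forall>x. R \<le> \<bar>x\<bar> \<longrightarrow> \<phi> x = 0"
    using test_function_support[OF assms(2)] by blast
  have *: "continuous_on UNIV (\<lambda>x. F x * \<phi> x)"
    using assms test_function_continuous by (intro continuous_intros) auto
  show "integrable lborel (\<lambda>x. F x * \<phi> x)" "integrable lebesgue (\<lambda>x. F x * \<phi> x)"
    by (rule integrable_compact_support[OF *, of R]; use R in force)+
qed

text \<open>The fundamental theorem of calculus is applied to \<open>F * \<phi>\<close> on an
  interval outside which \<open>\<phi>\<close> vanishes, so the boundary terms drop out. Continuity
  of \<open>F\<close> lets the derivative be unknown on a finite set \<open>S\<close>.\<close>

lemma test_function_integration_by_parts:
  fixes F f :: "real \<Rightarrow> real"
  assumes F: "continuous_on UNIV F" and f: "continuous_on UNIV f" and "finite S"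
    and deriv: "\<And>x. x \<notin> S \<Longrightarrow> (F has_real_derivative f x) (at x)"
    and \<phi>: "test_function \<phi>"
  shows "(LINT x|lebesgue. F x * deriv \<phi> x) = - (LINT x|lebesgue. f x * \<phi> x)"
proof -
  obtain R where "R > 0" and R: "\<forall>x. R \<le> \<bar>x\<bar> \<longrightarrow> \<phi> x = 0 \<and> deriv \<phi> x = 0"
    using test_function_support[OF \<phi>] by blast
  let ?g = "\<lambda>x. F x * deriv \<phi> x + f x * \<phi> x"
  have 1: "integrable lborel (\<lambda>x. F x * deriv \<phi> x)" "integrable lebesgue (\<lambda>x. F x * deriv \<phi> x)"
    using integrable_mult_test_function[OF F test_function_deriv[OF \<phi>]] .
  have 2: "integrable lborel (\<lambda>x. f x * \<phi> x)" "integrable lebesgue (\<lambda>x. f x * \<phi> x)"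
    using integrable_mult_test_function[OF f \<phi>] .
  have "(?g has_integral (F R * \<phi> R - F (-R) * \<phi> (-R))) {-R..R}"
  proof (rule fundamental_theorem_of_calculus_interior_strong[OF \<open>finite S\<close>])
    fix x assume "x \<in> {-R<..<R} - S"
    then show "((\<lambda>x. F x * \<phi> x) has_vector_derivative ?g x) (at x)"
      unfolding has_real_derivative_iff_has_vector_derivative[symmetric]
      by (auto intro!: derivative_eq_intros deriv test_function_has_deriv[OF \<phi>])
  next
    show "continuous_on {-R..R} (\<lambda>x. F x * \<phi> x)"
      using F test_function_continuous[OF \<phi>]
      by (intro continuous_on_mult) (auto intro: continuous_on_subset)
  qed (use \<open>R > 0\<close> in simp)
  then have "(?g has_integral 0) {-R..R}"
    using R \<open>R > 0\<close> by simp
  then have "(?g has_integral 0) UNIV"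
    by (rule has_integral_on_superset) (use R in \<open>auto simp: abs_le_iff not_le\<close>)
  moreover have "(?g has_integral (LINT x|lborel. ?g x)) UNIV"
    using 1 2 by (intro has_integral_integral_lborel) auto
  ultimately have "(LINT x|lborel. ?g x) = 0"
    using has_integral_unique by blast
  moreover have "(LINT x|lebesgue. ?g x) = (LINT x|lborel. ?g x)"
    using 1 2 by (intro integral_completion) auto
  ultimately show ?thesis
    using 1 2 by simp
qed

section \<open>Scalar first-order equations and the homoclinic profile\<close>

text \<open>Since \<open>Q y - Q x = (W y - W x) * (W y + W x)\<close>, the difference quotient of
  \<open>W\<close> is that of \<open>Q\<close> divided by \<open>W y + W x\<close>, whose limit
  \<open>2 * W x\<close> is nonzero. This recovers a second-order equation from its first integral
  without choosing a branch of the square root.\<close>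

lemma has_real_derivative_of_square:
  fixes W Q :: "real \<Rightarrow> real"
  assumes sq: "\<And>y. (W y)\<^sup>2 = Q y" and Q: "(Q has_real_derivative 2 * W x * c) (at x)"
    and W: "isCont W x" and nz: "W x \<noteq> 0"
  shows "(W has_real_derivative c) (at x)"
  unfolding has_field_derivative_iff
proof (rule Lim_transform_eventually)
  have *: "(\<lambda>y. W y + W x) \<midarrow>x\<rightarrow> W x + W x"
    using W by (intro tendsto_intros) (simp add: isCont_def)
  have "(\<lambda>y. ((Q y - Q x) / (y - x)) / (W y + W x)) \<midarrow>x\<rightarrow> (2 * W x * c) / (W x + W x)"
    using Q * nz by (intro tendsto_divide) (auto simp: has_field_derivative_iff)
  then show "(\<lambda>y. ((Q y - Q x) / (y - x)) / (W y + W x)) \<midarrow>x\<rightarrow> c"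
    using nz by simp
  have "eventually (\<lambda>y. W y + W x \<noteq> 0) (at x)"
    using nz by (intro tendsto_imp_eventually_ne[OF *]) simp
  then show "eventually (\<lambda>y. ((Q y - Q x) / (y - x)) / (W y + W x) = (W y - W x) / (y - x)) (at x)"
  proof eventually_elim
    case (elim y)
    have "Q y - Q x = (W y - W x) * (W y + W x)"
      by (simp flip: sq add: power2_eq_square algebra_simps)
    then show ?case using elim by simp
  qed
qed

text \<open>Separation of variables: \<open>y\<close> is the inverse of \<open>X\<close>, the
  primitive of \<open>1 / h\<close> with \<open>X 0 = 0\<close>. As \<open>h\<close> is merely
  continuous, this replaces a Lipschitz argument. Evenness of \<open>h\<close> makes
  \<open>X\<close>, and so \<open>y\<close>, odd.\<close>

lemma scalar_autonomous_ode:
  fixes h :: "real \<Rightarrow> real"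
  assumes cont: "continuous_on UNIV h" and even: "\<And>t. h (- t) = h t"
    and c: "c > 0" "\<And>t. c \<le> h t" and C: "\<And>t. h t \<le> C"
  obtains y where "\<And>x. (y has_real_derivative h (y x)) (at x)" "\<And>x. y (- x) = - y x"
    "\<And>x. c * \<bar>x\<bar> \<le> \<bar>y x\<bar>" "strict_mono y"
proof -
  have hpos: "h t > 0" for t
    using c(1) c(2)[of t] by linarith
  have "isCont (\<lambda>t. 1 / h t) t" for t
    using cont hpos[of t] by (intro continuous_intros) (auto simp: continuous_on_eq_continuous_at)
  then obtain F where F: "\<And>t. (F has_real_derivative 1 / h t) (at t)"
    using einterval_antiderivative[of "-\<infinity>" \<infinity> "\<lambda>t. 1 / h t"]
    by (auto simp: has_real_derivative_iff_has_vector_derivative)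
  define X where "X t = F t - F 0" for t
  have X: "(X has_real_derivative 1 / h t) (at t)" for t
    unfolding X_def by (auto intro!: derivative_eq_intros F)
  have X0: "X 0 = 0" by (simp add: X_def)
  have "((\<lambda>t. X t + X (- t)) has_real_derivative 0) (at t)" for t
    by (rule derivative_eq_intros X DERIV_chain2[OF X] | simp add: even)+
  then have "X t + X (- t) = X 0 + X (- 0)" for t
    using DERIV_isconst_all[of "\<lambda>t. X t + X (- t)" t 0] by simp
  then have Xodd: "X (- t) = - X t" for t
    by (simp add: X0 add_eq_0_iff)
  \<comment> \<open>The lower bound makes \<open>X\<close> strictly increasing and onto, so that
    \<open>y\<close> is defined on the whole line; the upper bound becomes the linear growth of
    \<open>y\<close>.\<close>
  have mvt: "(t - s) / C \<le> X t - X s \<and> X t - X s \<le> (t - s) / c" if "s < t" for s t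
  proof -
    obtain z where z: "X t - X s = (t - s) * (1 / h z)"
      using MVT2[of s t X "\<lambda>z. 1 / h z"] X \<open>s < t\<close> by blast
    have "1 / C \<le> 1 / h z" "1 / h z \<le> 1 / c"
      using c C[of z] hpos[of z] by (auto intro!: divide_left_mono mult_pos_pos intro: less_le_trans)
    then show ?thesis
      using \<open>s < t\<close> mult_left_mono[of "1 / C" "1 / h z" "t - s"] mult_left_mono[of "1 / h z" "1 / c" "t - s"]
      unfolding z by simp
  qed
  have "C > 0" using hpos[of 0] C[of 0] by linarith
  have mono: "strict_mono X"
    using mvt \<open>C > 0\<close> by (intro strict_monoI) (smt (verit) divide_pos_pos)
  have contX: "isCont X t" for t
    using X DERIV_isCont by blast
  have upper: "\<bar>x\<bar> \<le> X (C * \<bar>x\<bar>)" for x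
    using mvt[of 0 "C * \<bar>x\<bar>"] \<open>C > 0\<close> X0 by (cases "x = 0") auto
  have "\<exists>t. X t = x" for x
  proof -
    have "X (- (C * \<bar>x\<bar>)) \<le> x" "x \<le> X (C * \<bar>x\<bar>)"
      using upper[of x] by (auto simp: Xodd)
    then have "\<exists>t. - (C * \<bar>x\<bar>) \<le> t \<and> t \<le> C * \<bar>x\<bar> \<and> X t = x"
      using contX \<open>C > 0\<close> by (intro IVT) auto
    then show ?thesis by blast
  qed
  then have "surj X" by (metis surjI surj_def)
  define y where "y = inv X"
  have Xy: "X (y x) = x" for x
    unfolding y_def using \<open>surj X\<close> by (simp add: surj_f_inv_f)
  have inj: "inj X" using mono by (rule strict_mono_imp_inj_on)
  have yX: "y (X t) = t" for t
    unfolding y_def using inj by simp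
  have "isCont y x" for x
  proof -
    have "isCont y (X (y x))"
      by (rule isCont_inverse_function[where d = 1]) (use yX contX in auto)
    then show ?thesis by (simp add: Xy)
  qed
  then have "(y has_real_derivative inverse (1 / h (y x))) (at x)" for x
    using X[of "y x"] Xy hpos[of "y x"]
    by (intro DERIV_inverse_function[where f = X and g = y and x = x and D = "1 / h (y x)" and a = "x - 1" and b = "x + 1"])
      simp_all
  then have "(y has_real_derivative h (y x)) (at x)" for x
    by simp
  moreover have odd: "y (- x) = - y x" for x
    by (metis Xodd Xy yX)
  moreover have ymono: "strict_mono y"
  proof (rule strict_monoI)
    show "y s < y t" if "s < t" for s t
      using strict_mono_less[OF mono, of "y s" "y t"] that by (simp add: Xy)
  qed
  moreover have "c * \<bar>x\<bar> \<le> \<bar>y x\<bar>" for x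
  proof -
    have *: "c * x \<le> y x" if "x > 0" for x
    proof -
      have "y x > 0"
        using ymono \<open>x > 0\<close> by (metis X0 yX strict_mono_less)
      then have "x \<le> y x / c"
        using mvt[of 0 "y x"] by (simp add: Xy X0)
      then show ?thesis using c(1) by (simp add: field_simps)
    qed
    show ?thesis
      using *[of x] *[of "- x"] odd[of x] by (cases x "0::real" rule: linorder_cases) auto
  qed
  ultimately show ?thesis using that by blast
qed

text \<open>Used for the decay of the profile, through cosh^2 y = 1 + sinh^2 y >= 1 + y^2.\<close>

lemma abs_le_abs_sinh: "\<bar>x\<bar> \<le> \<bar>sinh x\<bar>" for x :: real
proof -
  have "sinh 0 - 0 \<le> sinh \<bar>x\<bar> - \<bar>x\<bar>"
  proof (rule DERIV_nonneg_imp_nondecreasing[of 0 "\<bar>x\<bar>" "\<lambda>t. sinh t - t"])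
    fix t :: real
    show "\<exists>d. ((\<lambda>t. sinh t - t) has_real_derivative d) (at t) \<and> 0 \<le> d"
      by (rule exI[of _ "cosh t - 1"]) (auto intro!: derivative_eq_intros simp: cosh_real_ge_1)
  qed simp
  then show ?thesis by (simp add: sinh_real_abs)
qed

text \<open>For v = m (1 - tanh^2 y) one has v' = -2 v tanh(y) y' and m - v = m tanh^2 y, so tanh^2
  y cancels from the squared equation and y'^2 = m K(v) / 4 remains. The claim that \<open>w\<close>
  vanishes only at 0 matters: the constant \<open>m\<close> also satisfies the squared
  equation.\<close>

lemma homoclinic_profile:
  fixes K :: "real \<Rightarrow> real"
  assumes "m > 0" and contK: "continuous_on {0..m} K" and posK: "\<And>v. v \<in> {0..m} \<Longrightarrow> K v > 0"
  obtains v w :: "real \<Rightarrow> real" and C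
  where "\<And>x. (v has_real_derivative w x) (at x)" "continuous_on UNIV w"
    "\<And>x. (w x)\<^sup>2 = (v x)\<^sup>2 * (m - v x) * K (v x)" "\<And>x. x \<noteq> 0 \<Longrightarrow> w x \<noteq> 0"
    "\<And>x. 0 < v x" "\<And>x. v x \<le> m" "\<And>x. v x \<le> C * inverse (1 + x\<^sup>2)"
    "\<And>x. v (- x) = v x" "\<And>x x'. \<bar>x\<bar> \<le> \<bar>x'\<bar> \<Longrightarrow> v x' \<le> v x"
proof -
  define g where "g t = m * (1 - (tanh t)\<^sup>2)" for t :: real
  have tanh2: "0 \<le> (tanh t)\<^sup>2" "(tanh t)\<^sup>2 < 1" for t :: real
    using tanh_real_bounds[of t] by (auto simp: abs_square_less_1)
  have g: "0 < g t" "g t \<le> m" for t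
    using tanh2[of t] \<open>m > 0\<close> by (auto simp: g_def mult_le_cancel_left1)
  have contg: "continuous_on UNIV g"
    unfolding g_def by (intro continuous_intros) auto
  obtain vm where vm: "vm \<in> {0..m}" "\<And>v. v \<in> {0..m} \<Longrightarrow> K vm \<le> K v"
    using continuous_attains_inf[of "{0..m}" K] contK \<open>m > 0\<close> by auto
  obtain vM where vM: "vM \<in> {0..m}" "\<And>v. v \<in> {0..m} \<Longrightarrow> K v \<le> K vM"
    using continuous_attains_sup[of "{0..m}" K] contK \<open>m > 0\<close> by auto
  define h where "h t = sqrt (m * K (g t)) / 2" for t
  \<comment> \<open>The cap at 1 serves the decay estimate, which uses
    \<open>c\<^sup>2 \<le> 1\<close>.\<close>
  define c where "c = min 1 (sqrt (m * K vm) / 2)"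
  have "c > 0" using posK[OF vm(1)] \<open>m > 0\<close> by (simp add: c_def)
  have gm: "g t \<in> {0..m}" for t using g[of t] by simp
  have conth: "continuous_on UNIV h"
    unfolding h_def using gm
    by (intro continuous_intros continuous_on_compose2[OF contK contg]) auto
  obtain y where y: "\<And>x. (y has_real_derivative h (y x)) (at x)" "\<And>x. y (- x) = - y x"
    "\<And>x. c * \<bar>x\<bar> \<le> \<bar>y x\<bar>" "strict_mono y"
  proof (rule scalar_autonomous_ode[of h c "sqrt (m * K vM) / 2"])
    show "h (- t) = h t" for t by (simp add: h_def g_def)
    have "sqrt (m * K vm) / 2 \<le> h t" for t
      using vm(2)[OF gm[of t]] \<open>m > 0\<close> by (simp add: h_def)
    then show "c \<le> h t" for t
      unfolding c_def by (rule min.coboundedI2)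
    show "h t \<le> sqrt (m * K vM) / 2" for t
      using vM(2)[OF gm[of t]] \<open>m > 0\<close> by (auto simp: h_def)
  qed (use conth \<open>c > 0\<close> in auto)
  define v where "v x = g (y x)" for x
  define w where "w x = - 2 * v x * tanh (y x) * h (y x)" for x
  have conty: "continuous_on UNIV y"
    using y(1) by (meson DERIV_isCont continuous_at_imp_continuous_on)
  have contv: "continuous_on UNIV v"
    unfolding v_def by (intro continuous_on_compose2[OF contg conty]) auto
  have hpos: "h t > 0" for t
    using posK[OF gm[of t]] \<open>m > 0\<close> by (simp add: h_def)
  have y0: "y 0 = 0" using y(2)[of 0] by simp
  show ?thesis
  proof
    show "(v has_real_derivative w x) (at x)" for x
      unfolding v_def w_def g_def
      by (rule derivative_eq_intros y refl | simp)+
    show "continuous_on UNIV w"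
      unfolding w_def
      by (intro continuous_intros contv conty continuous_on_compose2[OF conth conty]) auto
    show "(w x)\<^sup>2 = (v x)\<^sup>2 * (m - v x) * K (v x)" for x
    proof -
      have "(h (y x))\<^sup>2 = m * K (v x) / 4"
        using posK[OF gm] \<open>m > 0\<close> by (simp add: h_def v_def power_divide less_imp_le)
      moreover have "m - v x = m * (tanh (y x))\<^sup>2"
        by (simp add: v_def g_def algebra_simps)
      ultimately show ?thesis
        by (simp add: w_def power_mult_distrib)
    qed
    show v: "0 < v x" "v x \<le> m" for x
      using g by (auto simp: v_def)
    show "w x \<noteq> 0" if "x \<noteq> 0" for x
    proof -
      have "c * \<bar>x\<bar> > 0" using that \<open>c > 0\<close> by simp
      then have "y x \<noteq> 0" using y(3)[of x] by auto
      then show ?thesis using v(1)[of x] hpos[of "y x"] by (simp add: w_def)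
    qed
    \<comment> \<open>Here v = m / cosh^2 y, and cosh^2 y = 1 + sinh^2 y >= 1 + (c x)^2 >= c^2 (1 +
      x^2).\<close>
    show "v x \<le> m / c\<^sup>2 * inverse (1 + x\<^sup>2)" for x
    proof -
      have "\<bar>y x\<bar> \<le> \<bar>sinh (y x)\<bar>"
        by (rule abs_le_abs_sinh)
      then have "(y x)\<^sup>2 \<le> (sinh (y x))\<^sup>2"
        by (simp add: abs_le_square_iff)
      moreover have "(c * x)\<^sup>2 \<le> (y x)\<^sup>2"
        using y(3)[of x] \<open>c > 0\<close> by (simp add: abs_le_square_iff[symmetric] abs_mult)
      moreover have "c\<^sup>2 \<le> 1"
        using \<open>c > 0\<close> by (simp add: c_def power_le_one)
      ultimately have "c\<^sup>2 * (1 + x\<^sup>2) \<le> (cosh (y x))\<^sup>2"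
        by (simp add: cosh_square_eq power_mult_distrib algebra_simps)
      moreover have "v x = m / (cosh (y x))\<^sup>2"
        by (simp add: v_def g_def tanh_def power_divide field_simps) (simp add: cosh_square_eq algebra_simps)
      moreover have "c\<^sup>2 * (1 + x\<^sup>2) > 0"
        using \<open>c > 0\<close> by (simp add: add_pos_nonneg)
      ultimately have "v x \<le> m / (c\<^sup>2 * (1 + x\<^sup>2))"
        using \<open>m > 0\<close> by (auto intro!: divide_left_mono mult_pos_pos)
      then show ?thesis by (simp add: divide_inverse mult.assoc)
    qed
    show "v (- x) = v x" for x
      by (simp add: v_def g_def y)
    show "v x' \<le> v x" if "\<bar>x\<bar> \<le> \<bar>x'\<bar>" for x x'
    proof -
      \<comment> \<open>An odd increasing \<open>y\<close> commutes with the absolute value, so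
        \<open>\<bar>y x\<bar>\<close> grows with \<open>\<bar>x\<bar>\<close>.\<close>
      have *: "\<bar>y x\<bar> = y \<bar>x\<bar>" for x
        using strict_mono_less_eq[OF y(4), of 0 "\<bar>x\<bar>"] y(2)[of x] y0 by (auto simp: abs_if split: if_splits)
      have "\<bar>y x\<bar> \<le> \<bar>y x'\<bar>"
        using that strict_mono_less_eq[OF y(4)] by (simp add: *)
      then have "\<bar>tanh (y x)\<bar> \<le> \<bar>tanh (y x')\<bar>"
        by (simp flip: tanh_real_abs)
      then have "(tanh (y x))\<^sup>2 \<le> (tanh (y x'))\<^sup>2"
        by (simp add: abs_le_square_iff)
      then show ?thesis using \<open>m > 0\<close> by (simp add: v_def g_def)
    qed
  qed
qed

section \<open>From the profile to a solution of the system\<close>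

text \<open>
  The last factor in the hypothesis on \<open>K\<close> is \<open>U'\<^sup>2 / v\<^sup>2\<close> according to the first integral, and
  \<open>(2 a + 3 b v)\<^sup>2 / (4 \<alpha> (a + b v))\<close> is \<open>(dU / dv)\<^sup>2\<close>.
\<close>

lemma homoclinic_solution:
  fixes \<rho> \<alpha> a b m :: real and K :: "real \<Rightarrow> real"
  assumes "\<alpha> > 0" "\<rho> > 0" "a \<ge> 0" "b \<ge> 0" "a + b > 0" "m > 0"
    and contK: "continuous_on {0..m} K" and posK: "\<And>v. v \<in> {0..m} \<Longrightarrow> K v > 0"
    and K: "\<And>v. 0 < v \<Longrightarrow> v \<le> m \<Longrightarrow> (2 * a + 3 * b * v)\<^sup>2 * ((m - v) * K v) =
      4 * \<alpha> * (a + b * v) * (\<rho> * (a + b * v) + v\<^sup>2 * (a + b * v)\<^sup>2 / (2 * \<alpha>\<^sup>2)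
        - v * (2 * a / 3 + 3 * b * v / 4))"
  obtains U v where "solves_system \<rho> \<alpha> a b U (\<lambda>x. - v x)" "U \<in> H1_rd" "\<And>x. U x > 0" "\<And>x. v x > 0"
    "\<And>x. a * (v x)\<^sup>2 + b * v x ^ 3 = \<alpha> * (U x)\<^sup>2"
proof -
  obtain v w :: "real \<Rightarrow> real" and C where v: "\<And>x. (v has_real_derivative w x) (at x)"
    and contw: "continuous_on UNIV w"
    and w: "\<And>x. (w x)\<^sup>2 = (v x)\<^sup>2 * (m - v x) * K (v x)" "\<And>x. x \<noteq> 0 \<Longrightarrow> w x \<noteq> 0"
    and vpos: "\<And>x. 0 < v x" and vm: "\<And>x. v x \<le> m" and decay: "\<And>x. v x \<le> C * inverse (1 + x\<^sup>2)"
    and even: "\<And>x. v (- x) = v x" and decr: "\<And>x x'. \<bar>x\<bar> \<le> \<bar>x'\<bar> \<Longrightarrow> v x' \<le> v x"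
    using homoclinic_profile[OF \<open>m > 0\<close> contK posK] by blast
  have contv: "continuous_on UNIV v"
    using v by (meson DERIV_isCont continuous_at_imp_continuous_on)
  have ab: "a + b * t > 0" if "t > 0" for t
    using assms(3-5) that by (cases "a = 0") (auto intro: add_pos_nonneg)
  \<comment> \<open>Factoring \<open>v\<close> out of the positive root of \<alpha> U^2 = a v^2 + b
    v^3 leaves \<open>r\<close>. Then \<open>W\<close> is (dU/dv) v', that is, U'.\<close>
  define r where "r x = sqrt ((a + b * v x) / \<alpha>)" for x
  define U where "U x = v x * r x" for x
  define W where "W x = (2 * a + 3 * b * v x) / (2 * \<alpha> * r x) * w x" for x
  \<comment> \<open>\<open>v\<^sup>2 * p v\<close> is the first integral. By d(\<alpha> U^2) = (2 a
    v + 3 b v^2) dv, its term 2 \<alpha> \<integral> v U dU equals 2 a v^3 / 3 + 3 b v^4 /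
    4.\<close>
  define p where "p t = \<rho> * (a + b * t) + t\<^sup>2 * (a + b * t)\<^sup>2 / (2 * \<alpha>\<^sup>2) - t * (2 * a / 3 + 3 * b * t / 4)" for t
  have rpos: "r x > 0" and r2: "(r x)\<^sup>2 = (a + b * v x) / \<alpha>" for x
    using ab[OF vpos[of x]] \<open>\<alpha> > 0\<close> by (auto simp: r_def less_imp_le)
  have U2: "a * (v x)\<^sup>2 + b * v x ^ 3 = \<alpha> * (U x)\<^sup>2" for x
    using \<open>\<alpha> > 0\<close> by (simp add: U_def power_mult_distrib r2) (simp add: algebra_simps power2_eq_square power3_eq_cube)
  have Upos: "U x > 0" for x
    using vpos rpos by (simp add: U_def)
  have contr: "continuous_on UNIV r"
    unfolding r_def using \<open>\<alpha> > 0\<close> by (intro continuous_intros contv) auto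
  have contU: "continuous_on UNIV U"
    unfolding U_def by (intro continuous_intros contv contr)
  have contW: "continuous_on UNIV W"
    unfolding W_def using rpos \<open>\<alpha> > 0\<close>
    by (intro continuous_intros contv contr contw) (auto simp: less_imp_neq[THEN not_sym])
  have derivr: "(r has_real_derivative b * w x / (2 * \<alpha> * r x)) (at x)" for x
    unfolding r_def using ab[OF vpos[of x]] \<open>\<alpha> > 0\<close>
    by (auto intro!: derivative_eq_intros v simp: field_simps)
  have derivU: "(U has_real_derivative W x) (at x)" for x
  proof -
    have "(U has_real_derivative w x * r x + v x * (b * w x / (2 * \<alpha> * r x))) (at x)"
      unfolding U_def by (auto intro!: derivative_eq_intros v derivr)
    moreover have "w x * r x + v x * (b * w x / (2 * \<alpha> * r x)) = W x"
    proof -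
      have "\<alpha> * (r x)\<^sup>2 = a + b * v x" using r2[of x] \<open>\<alpha> > 0\<close> by simp
      then show ?thesis
        using rpos[of x] \<open>\<alpha> > 0\<close> unfolding W_def
        by (simp add: field_simps power2_eq_square) algebra
    qed
    ultimately show ?thesis by simp
  qed
  have W2: "(W x)\<^sup>2 = (v x)\<^sup>2 * p (v x)" for x
  proof -
    have "(W x)\<^sup>2 = (v x)\<^sup>2 * ((2 * a + 3 * b * v x)\<^sup>2 * ((m - v x) * K (v x))) / (4 * \<alpha>\<^sup>2 * (r x)\<^sup>2)"
      unfolding W_def by (simp add: power_mult_distrib power_divide w)
    also have "(2 * a + 3 * b * v x)\<^sup>2 * ((m - v x) * K (v x)) = 4 * \<alpha> * (\<alpha> * (r x)\<^sup>2) * p (v x)"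
      using K[OF vpos vm, of x] \<open>\<alpha> > 0\<close> by (simp add: p_def r2)
    also have "(v x)\<^sup>2 * (4 * \<alpha> * (\<alpha> * (r x)\<^sup>2) * p (v x)) / (4 * \<alpha>\<^sup>2 * (r x)\<^sup>2) = (v x)\<^sup>2 * p (v x)"
      using rpos[of x] \<open>\<alpha> > 0\<close> by (simp add: power2_eq_square)
    finally show ?thesis .
  qed
  \<comment> \<open>The value that the equation prescribes for U'' when V = -v.\<close>
  define f where "f x = U x ^ 3 + \<alpha> * (\<rho> - v x) * U x" for x
  have contf: "continuous_on UNIV f"
    unfolding f_def by (intro continuous_intros contU contv)
  \<comment> \<open>Differentiating the first integral says nothing at the turning point \<open>x = 0\<close>, where \<open>W = 0\<close>; one
    exceptional point is harmless for integration by parts, as \<open>W\<close> is continuous there.\<close>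
  have derivW: "(W has_real_derivative f x) (at x)" if "x \<notin> {0}" for x
  proof (rule has_real_derivative_of_square[OF W2])
    have "((\<lambda>x. (v x)\<^sup>2 * p (v x)) has_real_derivative
      (2 * a * v x + 3 * b * (v x)\<^sup>2) * (\<rho> + (v x)\<^sup>2 * (a + b * v x) / \<alpha>\<^sup>2 - v x) * w x) (at x)"
      unfolding p_def using \<open>\<alpha> > 0\<close>
      by (auto intro!: derivative_eq_intros v simp: field_simps power2_eq_square)
    moreover have "2 * W x * f x =
      (2 * a * v x + 3 * b * (v x)\<^sup>2) * (\<rho> + (v x)\<^sup>2 * (a + b * v x) / \<alpha>\<^sup>2 - v x) * w x"
    proof -
      \<comment> \<open>\<open>E\<close> is f / (\<alpha> U), so the equation reads U'' = \<alpha> E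
        U; it is also the common factor in the derivative of the first integral.\<close>
      define E where "E = \<rho> + (v x)\<^sup>2 * (a + b * v x) / \<alpha>\<^sup>2 - v x"
      have "f x = \<alpha> * v x * r x * E"
      proof -
        have "U x ^ 3 = v x ^ 3 * r x * (r x)\<^sup>2"
          by (simp add: U_def power2_eq_square power3_eq_cube)
        also have "\<dots> = v x ^ 3 * r x * ((a + b * v x) / \<alpha>)"
          by (simp only: r2)
        finally have "U x ^ 3 = v x ^ 3 * r x * ((a + b * v x) / \<alpha>)" .
        then show ?thesis
          using \<open>\<alpha> > 0\<close> by (simp only: f_def) (simp add: U_def E_def field_simps power2_eq_square power3_eq_cube)
      qed
      then show ?thesis
        unfolding E_def[symmetric]
        using rpos[of x] \<open>\<alpha> > 0\<close> by (simp add: W_def power2_eq_square field_simps)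
    qed
    ultimately show "((\<lambda>x. (v x)\<^sup>2 * p (v x)) has_real_derivative 2 * W x * f x) (at x)"
      by simp
    show "isCont W x"
      using contW by (simp add: continuous_on_eq_continuous_at)
    have "2 * a + 3 * b * v x > 0"
      using assms(3-5) vpos[of x] by (cases "a = 0") (auto intro: add_pos_nonneg)
    then show "W x \<noteq> 0"
      using w(2)[of x] that rpos[of x] \<open>\<alpha> > 0\<close> by (simp add: W_def)
  qed

  have weakU: "(LINT x|lebesgue. U x * deriv \<phi> x) = - (LINT x|lebesgue. W x * \<phi> x)"
    if "test_function \<phi>" for \<phi>
    using test_function_integration_by_parts[OF contU contW _ _ that, of "{}"] derivU by simp
  have weakW: "(LINT x|lebesgue. W x * deriv \<phi> x) = - (LINT x|lebesgue. f x * \<phi> x)"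
    if "test_function \<phi>" for \<phi>
    using test_function_integration_by_parts[OF contW contf _ derivW that, of "{0}"] by simp

  \<comment> \<open>One factor \<open>v\<close> supplies the quadratic decay, the other is bounded
    by \<open>m\<close>. Both U^2 and W^2 have the form \<open>v\<^sup>2 * q\<close>, with
    \<open>q\<close> bounded above.\<close>
  have sq_le: "(v x)\<^sup>2 * q \<le> m * B * C * inverse (1 + x\<^sup>2)" if "0 \<le> B" "q \<le> B" for x q B
  proof -
    have "(v x)\<^sup>2 * q \<le> (v x)\<^sup>2 * B"
      using that by (intro mult_left_mono) auto
    also have "\<dots> \<le> (m * (C * inverse (1 + x\<^sup>2))) * B"
      unfolding power2_eq_square[of "v x"] using vpos[of x] vm[of x] decay[of x] that \<open>m > 0\<close>
      by (intro mult_right_mono mult_mono) auto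
    finally show ?thesis by (simp add: algebra_simps)
  qed
  have abm: "a + b * v x \<le> a + b * m" for x
    using vm[of x] \<open>b \<ge> 0\<close> by (simp add: mult_left_mono)
  have "U \<in> L2"
  proof -
    have "(U x)\<^sup>2 \<le> m * ((a + b * m) / \<alpha>) * C * inverse (1 + x\<^sup>2)" for x
      unfolding U_def power_mult_distrib r2 using ab[OF \<open>m > 0\<close>] abm[of x] \<open>\<alpha> > 0\<close>
      by (intro sq_le) (auto intro: divide_right_mono)
    then have "integrable lebesgue (\<lambda>x. (U x)\<^sup>2)"
      by (intro integrable_lebesgue_quadratic_decay[rotated] continuous_intros contU) (simp only: abs_power2)
    then show ?thesis
      using contU by (simp add: L2_def borel_measurable_continuous_onI measurable_completion)
  qed
  moreover have "W \<in> L2"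
  proof -
    \<comment> \<open>Drop the subtracted term of \<open>p\<close>, which is nonnegative, and
      replace \<open>v\<close> by \<open>m\<close> in the others.\<close>
    let ?B = "\<rho> * (a + b * m) + m\<^sup>2 * (a + b * m)\<^sup>2 / (2 * \<alpha>\<^sup>2)"
    have "p (v x) \<le> ?B" for x
    proof -
      have "\<rho> * (a + b * v x) \<le> \<rho> * (a + b * m)"
        using abm[of x] \<open>\<rho> > 0\<close> by simp
      moreover have "(v x)\<^sup>2 * (a + b * v x)\<^sup>2 / (2 * \<alpha>\<^sup>2) \<le> m\<^sup>2 * (a + b * m)\<^sup>2 / (2 * \<alpha>\<^sup>2)"
        using vpos[of x] vm[of x] abm[of x] ab[OF vpos[of x]]
        by (intro divide_right_mono mult_mono power_mono) auto
      moreover have "v x * (2 * a / 3 + 3 * b * v x / 4) \<ge> 0"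
        using vpos[of x] assms(3,4) by simp
      ultimately show ?thesis by (simp add: p_def)
    qed
    moreover have "?B \<ge> 0"
      using ab[OF \<open>m > 0\<close>] \<open>\<rho> > 0\<close> by simp
    ultimately have "(W x)\<^sup>2 \<le> m * ?B * C * inverse (1 + x\<^sup>2)" for x
      unfolding W2 by (intro sq_le)
    then have "integrable lebesgue (\<lambda>x. (W x)\<^sup>2)"
      by (intro integrable_lebesgue_quadratic_decay[rotated] continuous_intros contW) (simp only: abs_power2)
    then show ?thesis
      using contW by (simp add: L2_def borel_measurable_continuous_onI measurable_completion)
  qed
  moreover have "has_weak_deriv U W"
    unfolding has_weak_deriv_def using contU contW weakU by (auto intro: locally_integrable_continuous)
  ultimately have "U \<in> H1"
    by (auto simp: H1_def)
  moreover have "U x' \<le> U x" if "\<bar>x\<bar> \<le> \<bar>x'\<bar>" for x x'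
    unfolding U_def r_def using decr[OF that] vpos[of x'] vpos[of x] \<open>b \<ge> 0\<close> \<open>\<alpha> > 0\<close> ab[OF vpos[of x']]
    by (intro mult_mono real_sqrt_le_mono divide_right_mono add_left_mono mult_left_mono) auto
  ultimately have "U \<in> H1_rd"
    by (auto simp: H1_rd_def U_def r_def even)
  moreover have "solves_system \<rho> \<alpha> a b U (\<lambda>x. - v x)"
    unfolding solves_system_def
  proof (intro conjI allI impI)
    fix \<phi> assume \<phi>: "test_function \<phi>"
    have "(LINT x|lebesgue. U x * deriv (deriv \<phi>) x) = (LINT x|lebesgue. f x * \<phi> x)"
      using weakU[OF test_function_deriv[OF \<phi>]] weakW[OF \<phi>] by simp
    moreover have "integrable lebesgue (\<lambda>x. U x * deriv (deriv \<phi>) x)" "integrable lebesgue (\<lambda>x. f x * \<phi> x)"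
      using integrable_mult_test_function(2) \<phi> test_function_deriv contU contf by auto
    ultimately have "(LINT x|lebesgue. U x * deriv (deriv \<phi>) x - f x * \<phi> x) = 0"
      by simp
    moreover have "U x * deriv (deriv \<phi>) x - f x * \<phi> x = U x * deriv (deriv \<phi>) x
            - U x ^ 3 * \<phi> x - \<alpha> * (- v x + \<rho>) * U x * \<phi> x" for x
      by (simp add: f_def algebra_simps)
    ultimately show "(LINT x|lebesgue. U x * deriv (deriv \<phi>) x
            - U x ^ 3 * \<phi> x - \<alpha> * (- v x + \<rho>) * U x * \<phi> x) = 0"
      by simp
  next
    fix \<phi>
    have "a * (- v x)\<^sup>2 - b * (- v x) ^ 3 = \<alpha> * (U x)\<^sup>2" for x
      using U2[of x] by simp
    then show "- (LINT x|lebesgue. (a * (- v x)\<^sup>2 - b * (- v x) ^ 3) * deriv \<phi> x) =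
      - (LINT x|lebesgue. \<alpha> * (U x)\<^sup>2 * deriv \<phi> x)"
      by simp
  qed (intro locally_integrable_continuous continuous_intros contU contv)+
  ultimately show ?thesis
    using that Upos vpos U2 by blast
qed

section \<open>Explicit coefficients in the three cases\<close>

theorem theorem1p3:
  fixes \<rho> \<alpha> :: real
  assumes "\<rho> > 0" and "\<alpha> > 0"
  shows
    "(\<exists>b>0. \<exists>U V :: real \<Rightarrow> real. solves_system \<rho> \<alpha> 0 b U V \<and>
        U \<in> H1_rd \<and> (\<forall>x. U x > 0) \<and>
        (\<forall>x. V x = - ((\<alpha> / b) powr (1/3)) * U x powr (2/3))) \<and>
     (\<exists>a>0. \<exists>U V :: real \<Rightarrow> real. solves_system \<rho> \<alpha> a 0 U V \<and>
        U \<in> H1_rd \<and> (\<forall>x. U x > 0) \<and>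
        (\<forall>x. V x = - ((\<alpha> / a) powr (1/2)) * U x)) \<and>
     (\<exists>a>0. \<exists>b>0. \<exists>U V :: real \<Rightarrow> real. solves_system \<rho> \<alpha> a b U V \<and>
        (\<forall>x. U x > 0) \<and> U \<in> H1_rd \<and> (\<forall>x. V x < 0) \<and>
        (AE x in lebesgue. a * (V x)\<^sup>2 - b * V x ^ 3 = \<alpha> * (U x)\<^sup>2))"
proof (intro conjI)
  \<comment> \<open>In all three cases \<open>m\<close> is a fixed multiple of \<open>\<rho>\<close>, and the coefficients are determined by \<open>G(m) = 0\<close>
    (in the third case after imposing \<open>b = a / \<rho>\<close>); \<open>K\<close> is the cofactor of \<open>m - v\<close>.\<close>
  define b where "b = 2 * \<alpha>\<^sup>2 / (27 * \<rho>\<^sup>2)"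
  have "b > 0" using assms by (simp add: b_def)
  obtain U v where U: "solves_system \<rho> \<alpha> 0 b U (\<lambda>x. - v x)" "U \<in> H1_rd" "\<And>x. U x > 0" "\<And>x. v x > 0"
    "\<And>x. 0 * (v x)\<^sup>2 + b * v x ^ 3 = \<alpha> * (U x)\<^sup>2"
  \<comment> \<open>With s = v / \<rho>, the first integral over v^2 is b v \<rho> (1 - 3 s / 4 +
    s^3 / 27), and the cubic factors as (3/2 - s) (72 - 6 s - 4 s^2) / 108.\<close>
  proof (rule homoclinic_solution[of \<alpha> \<rho> 0 b "3 * \<rho> / 2" "\<lambda>v. \<alpha> / 243 * (72 - 6 * (v / \<rho>) - 4 * (v / \<rho>)\<^sup>2)"])
    fix v assume v: "v \<in> {0..3 * \<rho> / 2}"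
    define s where "s = v / \<rho>"
    have s: "0 \<le> s" "s \<le> 3 / 2" using v assms by (auto simp: s_def field_simps)
    then have "s * s \<le> 3 / 2 * (3 / 2)" by (intro mult_mono) auto
    with s have "72 - 6 * s - 4 * s\<^sup>2 > 0"
      unfolding power2_eq_square by simp
    then show "\<alpha> / 243 * (72 - 6 * (v / \<rho>) - 4 * (v / \<rho>)\<^sup>2) > 0"
      unfolding s_def[symmetric] using assms by simp
  next
    fix v
    show "(2 * 0 + 3 * b * v)\<^sup>2 * ((3 * \<rho> / 2 - v) * (\<alpha> / 243 * (72 - 6 * (v / \<rho>) - 4 * (v / \<rho>)\<^sup>2))) =
      4 * \<alpha> * (0 + b * v) * (\<rho> * (0 + b * v) + v\<^sup>2 * (0 + b * v)\<^sup>2 / (2 * \<alpha>\<^sup>2)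
        - v * (2 * 0 / 3 + 3 * b * v / 4))"
      using assms unfolding b_def by (simp add: field_simps power2_eq_square)
  qed (use assms \<open>b > 0\<close> in \<open>auto intro!: continuous_intros\<close>)
  have "v x = (\<alpha> / b) powr (1/3) * U x powr (2/3)" for x
  proof -
    have "(\<alpha> / b) powr (1/3) * U x powr (2/3) = (\<alpha> / b) powr (1/3) * ((U x)\<^sup>2) powr (1/3)"
      using U(3)[of x] by (simp flip: powr_numeral add: powr_powr)
    also have "\<dots> = (\<alpha> / b * (U x)\<^sup>2) powr (1/3)"
      using assms \<open>b > 0\<close> by (intro powr_mult[symmetric])
    also have "\<alpha> / b * (U x)\<^sup>2 = v x ^ 3"
      using U(5)[of x] \<open>b > 0\<close> by (simp add: field_simps)
    also have "(v x ^ 3) powr (1/3) = v x"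
      using U(4)[of x] by (simp flip: powr_numeral add: powr_powr)
    finally show ?thesis ..
  qed
  then show "\<exists>b>0. \<exists>U V :: real \<Rightarrow> real. solves_system \<rho> \<alpha> 0 b U V \<and>
        U \<in> H1_rd \<and> (\<forall>x. U x > 0) \<and>
        (\<forall>x. V x = - ((\<alpha> / b) powr (1/3)) * U x powr (2/3))"
    using U(1-3) \<open>b > 0\<close> by (intro exI[of _ b] exI[of _ U] exI[of _ "\<lambda>x. - v x"] conjI) auto
next
  define a where "a = \<alpha>\<^sup>2 / (6 * \<rho>)"
  have "a > 0" using assms by (simp add: a_def)
  obtain U v where U: "solves_system \<rho> \<alpha> a 0 U (\<lambda>x. - v x)" "U \<in> H1_rd" "\<And>x. U x > 0" "\<And>x. v x > 0"
    "\<And>x. a * (v x)\<^sup>2 + 0 * v x ^ 3 = \<alpha> * (U x)\<^sup>2"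
  \<comment> \<open>With s = v / \<rho>, the first integral over v^2 is a \<rho> (1 - 2 s / 3 + s^2
    / 12) = a \<rho> (2 - s) (6 - s) / 12; the second root lies beyond \<open>m\<close>.\<close>
  proof (rule homoclinic_solution[of \<alpha> \<rho> a 0 "2 * \<rho>" "\<lambda>v. \<alpha> / 12 * (6 - v / \<rho>)"])
    fix v assume v: "v \<in> {0..2 * \<rho>}"
    then show "\<alpha> / 12 * (6 - v / \<rho>) > 0" using assms by (simp add: field_simps)
  next
    fix v
    show "(2 * a + 3 * 0 * v)\<^sup>2 * ((2 * \<rho> - v) * (\<alpha> / 12 * (6 - v / \<rho>))) =
      4 * \<alpha> * (a + 0 * v) * (\<rho> * (a + 0 * v) + v\<^sup>2 * (a + 0 * v)\<^sup>2 / (2 * \<alpha>\<^sup>2)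
        - v * (2 * a / 3 + 3 * 0 * v / 4))"
      using assms unfolding a_def by (simp add: field_simps power2_eq_square)
  qed (use assms \<open>a > 0\<close> in \<open>auto intro!: continuous_intros\<close>)
  have "v x = (\<alpha> / a) powr (1/2) * U x" for x
  proof -
    have "(\<alpha> / a) powr (1/2) * U x = sqrt (\<alpha> / a) * sqrt ((U x)\<^sup>2)"
      using U(3)[of x] assms \<open>a > 0\<close> by (simp add: powr_half_sqrt)
    also have "\<dots> = sqrt (\<alpha> / a * (U x)\<^sup>2)"
      by (simp only: real_sqrt_mult)
    also have "\<alpha> / a * (U x)\<^sup>2 = (v x)\<^sup>2"
      using U(5)[of x] \<open>a > 0\<close> by (simp add: field_simps)
    finally show ?thesis using U(4)[of x] by simp
  qed
  then show "\<exists>a>0. \<exists>U V :: real \<Rightarrow> real. solves_system \<rho> \<alpha> a 0 U V \<and>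
        U \<in> H1_rd \<and> (\<forall>x. U x > 0) \<and>
        (\<forall>x. V x = - ((\<alpha> / a) powr (1/2)) * U x)"
    using U(1-3) \<open>a > 0\<close> by (intro exI[of _ a] exI[of _ U] exI[of _ "\<lambda>x. - v x"] conjI) auto
next
  define a where "a = 2 * \<alpha>\<^sup>2 / (27 * \<rho>)"
  define b where "b = a / \<rho>"
  have "a > 0" using assms by (simp add: a_def)
  have "b > 0" using assms \<open>a > 0\<close> by (simp add: b_def)
  \<comment> \<open>With s = v / \<rho>, the first integral over v^2 is a \<rho> (2 - s) (54 + 45 s
    - 16 s^2 - 4 s^3) / 108. Dividing by (dU/dv)^2 produces the factor 4 \<alpha> (1 + s) / (2 + 3
    s)^2.\<close>
  define K where "K v = 4 * \<alpha> * (1 + v / \<rho>) * (54 + 45 * (v / \<rho>) - 16 * (v / \<rho>)\<^sup>2 - 4 * (v / \<rho>) ^ 3)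
    / (108 * (2 + 3 * (v / \<rho>))\<^sup>2)" for v
  obtain U v where U: "solves_system \<rho> \<alpha> a b U (\<lambda>x. - v x)" "U \<in> H1_rd" "\<And>x. U x > 0" "\<And>x. v x > 0"
    "\<And>x. a * (v x)\<^sup>2 + b * v x ^ 3 = \<alpha> * (U x)\<^sup>2"
  proof (rule homoclinic_solution[of \<alpha> \<rho> a b "2 * \<rho>" K])
    show "continuous_on {0..2 * \<rho>} K"
      unfolding K_def using assms by (intro continuous_intros) (auto simp: add_nonneg_eq_0_iff)
  next
    fix v assume v: "v \<in> {0..2 * \<rho>}"
    define s where "s = v / \<rho>"
    have s: "0 \<le> s" "s \<le> 2" using v assms by (auto simp: s_def field_simps)
    \<comment> \<open>From s^2 <= 2 s and s^3 <= 4 s, the cubic is at least 54 - 3 s, which is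
      positive for s <= 2.\<close>
    have "s * s \<le> 2 * s"
      using s by (intro mult_right_mono)
    then have "s * (s * s) \<le> 2 * (2 * s)"
      using s by (intro mult_mono) auto
    with \<open>s * s \<le> 2 * s\<close> have "54 + 45 * s - 16 * s\<^sup>2 - 4 * s ^ 3 > 0"
      unfolding power2_eq_square power3_eq_cube using s by (simp add: mult.assoc)
    then show "K v > 0"
      unfolding K_def s_def[symmetric] using s assms by (auto intro!: divide_pos_pos mult_pos_pos)
  next
    fix v assume v: "0 < v" "v \<le> 2 * \<rho>"
    define s where "s = v / \<rho>"
    have vs: "v = \<rho> * s" and s: "s > 0" using v assms by (auto simp: s_def)
    have bv: "b * v = a * s" using assms by (simp add: b_def vs)
    have ak: "a * \<rho> = 2 * \<alpha>\<^sup>2 / 27" using assms by (simp add: a_def)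
    have "(2 * a + 3 * b * v)\<^sup>2 * ((2 * \<rho> - v) * K v) = (a * (2 + 3 * s))\<^sup>2 * (\<rho> * (2 - s) * K v)"
      by (simp add: bv mult.assoc) (simp add: vs algebra_simps)
    also have "\<dots> = a\<^sup>2 * \<rho> * (2 - s) * (4 * \<alpha> * (1 + s) * (54 + 45 * s - 16 * s\<^sup>2 - 4 * s ^ 3) / 108)"
      unfolding K_def s_def[symmetric] using s by (simp add: power_mult_distrib)
    also have "\<dots> = 4 * \<alpha> * (a + a * s) * (a * \<rho> * ((1 + s) + s\<^sup>2 * (1 + s)\<^sup>2 / 27 - s * (2 / 3 + 3 * s / 4)))"
      by (simp add: field_simps power2_eq_square power3_eq_cube)
    also have "a * \<rho> * ((1 + s) + s\<^sup>2 * (1 + s)\<^sup>2 / 27 - s * (2 / 3 + 3 * s / 4)) =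
      \<rho> * (a + a * s) + v\<^sup>2 * (a + a * s)\<^sup>2 / (2 * \<alpha>\<^sup>2) - v * (2 * a / 3 + 3 * (a * s) / 4)"
    proof -
      have "v\<^sup>2 * (a + a * s)\<^sup>2 / (2 * \<alpha>\<^sup>2) = (a * \<rho>)\<^sup>2 * (s\<^sup>2 * (1 + s)\<^sup>2) / (2 * \<alpha>\<^sup>2)"
        by (simp add: vs field_simps power2_eq_square)
      also have "\<dots> = (a * \<rho>) * (s\<^sup>2 * (1 + s)\<^sup>2 / 27)"
        using assms by (simp add: ak power2_eq_square)
      finally show ?thesis
        by (simp add: vs algebra_simps)
    qed
    finally show "(2 * a + 3 * b * v)\<^sup>2 * ((2 * \<rho> - v) * K v) =
      4 * \<alpha> * (a + b * v) * (\<rho> * (a + b * v) + v\<^sup>2 * (a + b * v)\<^sup>2 / (2 * \<alpha>\<^sup>2)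
        - v * (2 * a / 3 + 3 * b * v / 4))"
      by (simp add: bv mult.assoc)
  qed (use assms \<open>a > 0\<close> \<open>b > 0\<close> in auto)
  then show "\<exists>a>0. \<exists>b>0. \<exists>U V :: real \<Rightarrow> real. solves_system \<rho> \<alpha> a b U V \<and>
        (\<forall>x. U x > 0) \<and> U \<in> H1_rd \<and> (\<forall>x. V x < 0) \<and>
        (AE x in lebesgue. a * (V x)\<^sup>2 - b * V x ^ 3 = \<alpha> * (U x)\<^sup>2)"
    using \<open>a > 0\<close> \<open>b > 0\<close>
    by (intro exI[of _ a] exI[of _ b] exI[of _ U] exI[of _ "\<lambda>x. - v x"] conjI) auto
qed

end
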